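(* The class $C$ of all modal algebras $A$ which satisfy $\bigwedge_{n\in\omega}\Diamond^{n}1=0$ (that is, the greatest lower bound of $\{\Diamond^{n}1\mid n\in\omega\}$ in $A$ is $0$) and $\Box x\leq\Box\Box x$ for every $x\in A$ is not a variety.
   Context: A modal algebra is an algebra $\langle A;\lor,\land,-,\Box,0,1\rangle$ such that $\langle A;\lor,\land,-,0,1\rangle$ is a Boolean algebra, $\Box 1=1$, and $\Box x\land\Box y=\Box(x\land y)$ for all $x,y\in A$. Write $\Diamond x$ for $-\Box{-}x$, and $\Diamond^{n}$ for its $n$-fold application. A variety is a class of algebras, in the signature $(\lor,\land,-,\Box,0,1)$, which is the class of all models of some set of equations between (finitary) terms in this signature. *)

theory Defs
  imports "HOL-Algebra.Order"
begin

record 'a modal_alg = "'a partial_object" +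
  vee :: "'a \<Rightarrow> 'a \<Rightarrow> 'a"
  wedge :: "'a \<Rightarrow> 'a \<Rightarrow> 'a"
  compl :: "'a \<Rightarrow> 'a"
  box :: "'a \<Rightarrow> 'a"
  zero :: 'a
  one :: 'a

text \<open>An arbitrary algebra in the signature; the constants make the carrier nonempty.\<close>

locale sig_algebra =
  fixes A :: "('a, 'b) modal_alg_scheme" (structure)
  assumes vee_closed: "\<lbrakk>x \<in> carrier A; y \<in> carrier A\<rbrakk> \<Longrightarrow> vee A x y \<in> carrier A"
    and wedge_closed: "\<lbrakk>x \<in> carrier A; y \<in> carrier A\<rbrakk> \<Longrightarrow> wedge A x y \<in> carrier A"
    and compl_closed: "x \<in> carrier A \<Longrightarrow> compl A x \<in> carrier A"
    and box_closed: "x \<in> carrier A \<Longrightarrow> box A x \<in> carrier A"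
    and zero_closed: "zero A \<in> carrier A"
    and one_closed: "one A \<in> carrier A"

text \<open>The Boolean part is a complemented distributive lattice with bounds; the one-element algebra
  (with \<open>0 = 1\<close>) is allowed.\<close>

locale modal_algebra = sig_algebra +
  assumes vee_assoc: "\<lbrakk>x \<in> carrier A; y \<in> carrier A; z \<in> carrier A\<rbrakk>
      \<Longrightarrow> vee A (vee A x y) z = vee A x (vee A y z)"
    and wedge_assoc: "\<lbrakk>x \<in> carrier A; y \<in> carrier A; z \<in> carrier A\<rbrakk>
      \<Longrightarrow> wedge A (wedge A x y) z = wedge A x (wedge A y z)"
    and vee_comm: "\<lbrakk>x \<in> carrier A; y \<in> carrier A\<rbrakk> \<Longrightarrow> vee A x y = vee A y x"
    and wedge_comm: "\<lbrakk>x \<in> carrier A; y \<in> carrier A\<rbrakk> \<Longrightarrow> wedge A x y = wedge A y x"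
    and vee_absorb: "\<lbrakk>x \<in> carrier A; y \<in> carrier A\<rbrakk> \<Longrightarrow> vee A x (wedge A x y) = x"
    and wedge_absorb: "\<lbrakk>x \<in> carrier A; y \<in> carrier A\<rbrakk> \<Longrightarrow> wedge A x (vee A x y) = x"
    and wedge_distrib: "\<lbrakk>x \<in> carrier A; y \<in> carrier A; z \<in> carrier A\<rbrakk>
      \<Longrightarrow> wedge A x (vee A y z) = vee A (wedge A x y) (wedge A x z)"
    and vee_distrib: "\<lbrakk>x \<in> carrier A; y \<in> carrier A; z \<in> carrier A\<rbrakk>
      \<Longrightarrow> vee A x (wedge A y z) = wedge A (vee A x y) (vee A x z)"
    and vee_zero: "x \<in> carrier A \<Longrightarrow> vee A x (zero A) = x"
    and wedge_one: "x \<in> carrier A \<Longrightarrow> wedge A x (one A) = x"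
    and vee_compl: "x \<in> carrier A \<Longrightarrow> vee A x (compl A x) = one A"
    and wedge_compl: "x \<in> carrier A \<Longrightarrow> wedge A x (compl A x) = zero A"
    and box_one: "box A (one A) = one A"
    and box_wedge: "\<lbrakk>x \<in> carrier A; y \<in> carrier A\<rbrakk>
      \<Longrightarrow> wedge A (box A x) (box A y) = box A (wedge A x y)"

definition diamond :: "('a, 'b) modal_alg_scheme \<Rightarrow> 'a \<Rightarrow> 'a"
  where "diamond A x = compl A (box A (compl A x))"

definition bool_order :: "('a, 'b) modal_alg_scheme \<Rightarrow> 'a gorder"
  where "bool_order A = \<lparr>carrier = carrier A, eq = (=), le = (\<lambda>x y. wedge A x y = x)\<rparr>"

definition C :: "'a modal_alg set"
  where "C = {A. modal_algebra A
    \<and> greatest (bool_order A) (zero A)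
        (Lower (bool_order A) (range (\<lambda>n. (diamond A ^^ n) (one A))))
    \<and> (\<forall>x \<in> carrier A. box A x \<sqsubseteq>\<^bsub>bool_order A\<^esub> box A (box A x))}"

text \<open>Every equation involves only finitely many variables, so a countable supply suffices.\<close>

datatype trm =
    Var nat
  | Vee trm trm
  | Wedge trm trm
  | Compl trm
  | Box trm
  | Zero
  | One

primrec interp :: "('a, 'b) modal_alg_scheme \<Rightarrow> (nat \<Rightarrow> 'a) \<Rightarrow> trm \<Rightarrow> 'a"
  where
    "interp A v (Var i) = v i"
  | "interp A v (Vee s t) = vee A (interp A v s) (interp A v t)"
  | "interp A v (Wedge s t) = wedge A (interp A v s) (interp A v t)"
  | "interp A v (Compl t) = compl A (interp A v t)"
  | "interp A v (Box t) = box A (interp A v t)"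
  | "interp A v Zero = zero A"
  | "interp A v One = one A"

definition satisfies :: "('a, 'b) modal_alg_scheme \<Rightarrow> trm \<times> trm \<Rightarrow> bool"
  where "satisfies A e \<longleftrightarrow>
    (\<forall>v. range v \<subseteq> carrier A \<longrightarrow> interp A v (fst e) = interp A v (snd e))"

definition models :: "(trm \<times> trm) set \<Rightarrow> 'a modal_alg set"
  where "models E = {A. sig_algebra A \<and> (\<forall>e \<in> E. satisfies A e)}"

text \<open>A class of algebras is represented by its members whose carrier is a subset of the type
  \<open>'a\<close>, which acts as the universe. If a class of all algebras is the model class of \<open>E\<close>, then so is
  its part in each universe; hence failure of \<open>is_variety\<close> in any one universe shows that the full
  class is not a variety.\<close>

definition is_variety :: "'a modal_alg set \<Rightarrow> bool"
  where "is_variety K \<longleftrightarrow> (\<exists>E. K = models E)"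

end

theory Submission
  imports Defs "HOL-Library.Countable_Set"
begin

text \<open>
  The reason is a failure of compactness. On the set \<open>{0, 1, 2, \<dots>}\<close> let every \<open>k \<ge> 1\<close> see
  \<open>1, \<dots>, k - 1\<close>, and let \<open>0\<close> see every \<open>k \<ge> 1\<close>; thus \<open>0\<close> is a point of rank \<open>\<omega>\<close> on top of an
  infinite chain of points of finite rank. This relation is transitive, which gives
  \<open>\<box>x \<le> \<box>\<box>x\<close>. The set \<open>\<Diamond>\<^sup>n 1\<close> consists of the points from which a path of
  length \<open>n\<close> starts. On the finite part \<open>{0, \<dots>, n}\<close> paths have bounded length, so
  \<open>\<Diamond>\<^sup>k 1\<close> is empty for large \<open>k\<close>, and the algebra of all subsets lies in \<open>C\<close>. On the whole frame
  paths of every length start at \<open>0\<close>, so the nonzero element \<open>{0}\<close> lies below every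
  \<open>\<Diamond>\<^sup>n 1\<close>, and the algebra of finite and cofinite sets does not lie in \<open>C\<close>.

  Yet each equation that holds in all the finite algebras holds in the infinite one. For a fixed set
  \<open>X\<close>, intersecting with \<open>{0, \<dots>, n}\<close> commutes with \<open>\<box>\<close> as soon as \<open>n\<close> is large: only the point \<open>0\<close>
  could notice the truncation, and it does not once \<open>n\<close> exceeds some counterexample to \<open>0 \<in> \<box>X\<close>.
  Hence the truncation of the value of a term is the value of the term under the truncated
  valuation, for all large \<open>n\<close> (lemma \<open>eventually_truncate_interp\<close>). In other words, the infinite
  algebra embeds into a reduced product of the finite ones modulo the cofinite filter.

  Finite and cofinite sets are used, and not all sets, to keep the algebra countable: then it has an
  isomorphic copy in every infinite universe.
\<close>

section \<open>Membership in the class and isomorphic copies\<close>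

context sig_algebra
begin

lemma diamond_closed: "x \<in> carrier A \<Longrightarrow> diamond A x \<in> carrier A"
  by (simp add: diamond_def compl_closed box_closed)

lemma diamond_pow_closed: "(diamond A ^^ n) (one A) \<in> carrier A"
  by (induction n) (auto simp: diamond_closed one_closed)

end

text \<open>As \<open>0\<close> lies below every element, it is the greatest lower bound of the \<open>\<Diamond>\<^sup>n 1\<close> exactly if it is their
  only lower bound.\<close>

lemma mem_C_iff:
  "A \<in> C \<longleftrightarrow> modal_algebra A
    \<and> (\<forall>a \<in> carrier A. (\<forall>n. wedge A a ((diamond A ^^ n) (one A)) = a) \<longrightarrow> a = zero A)
    \<and> (\<forall>x \<in> carrier A. wedge A (box A x) (box A (box A x)) = box A x)"
proof (cases "modal_algebra A")
  case True
  then interpret modal_algebra A .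
  have wedge_zero: "wedge A (zero A) x = zero A" if "x \<in> carrier A" for x
    using that wedge_absorb[of "zero A" x] vee_comm[of "zero A" x] vee_zero zero_closed by simp
  have wedge_zero': "wedge A x (zero A) = zero A" if "x \<in> carrier A" for x
    using that wedge_zero[of x] wedge_comm[of x "zero A"] zero_closed by simp
  have "Lower (bool_order A) (range (\<lambda>n. (diamond A ^^ n) (one A)))
      = {a \<in> carrier A. \<forall>n. wedge A a ((diamond A ^^ n) (one A)) = a}"
    using diamond_pow_closed by (auto simp: Lower_def bool_order_def)
  then have "greatest (bool_order A) (zero A)
          (Lower (bool_order A) (range (\<lambda>n. (diamond A ^^ n) (one A))))
    \<longleftrightarrow> (\<forall>a \<in> carrier A. (\<forall>n. wedge A a ((diamond A ^^ n) (one A)) = a) \<longrightarrow> a = zero A)"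
    using diamond_pow_closed wedge_zero wedge_zero' zero_closed
    by (auto simp: greatest_def bool_order_def)
  with True show ?thesis by (simp add: C_def bool_order_def)
qed (simp add: C_def)

definition alg_iso :: "('a \<Rightarrow> 'b) \<Rightarrow> 'a modal_alg \<Rightarrow> 'b modal_alg \<Rightarrow> bool"
  where "alg_iso h A B \<longleftrightarrow> bij_betw h (carrier A) (carrier B)
    \<and> (\<forall>x \<in> carrier A. \<forall>y \<in> carrier A. h (vee A x y) = vee B (h x) (h y))
    \<and> (\<forall>x \<in> carrier A. \<forall>y \<in> carrier A. h (wedge A x y) = wedge B (h x) (h y))
    \<and> (\<forall>x \<in> carrier A. h (compl A x) = compl B (h x))
    \<and> (\<forall>x \<in> carrier A. h (box A x) = box B (h x))
    \<and> h (zero A) = zero B \<and> h (one A) = one B"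

locale isomorphic_algebras = A: sig_algebra A
  for A :: "'a modal_alg" +
  fixes h :: "'a \<Rightarrow> 'b" and B :: "'b modal_alg"
  assumes iso: "alg_iso h A B"
begin

lemma carrier_eq: "carrier B = h ` carrier A"
  and inj: "inj_on h (carrier A)"
  using iso by (auto simp: alg_iso_def bij_betw_def)

lemma ops:
  "\<lbrakk>x \<in> carrier A; y \<in> carrier A\<rbrakk> \<Longrightarrow> vee B (h x) (h y) = h (vee A x y)"
  "\<lbrakk>x \<in> carrier A; y \<in> carrier A\<rbrakk> \<Longrightarrow> wedge B (h x) (h y) = h (wedge A x y)"
  "x \<in> carrier A \<Longrightarrow> compl B (h x) = h (compl A x)"
  "x \<in> carrier A \<Longrightarrow> box B (h x) = h (box A x)"
  "zero B = h (zero A)" "one B = h (one A)"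
  using iso by (auto simp: alg_iso_def)

lemmas closed = A.vee_closed A.wedge_closed A.compl_closed A.box_closed A.zero_closed A.one_closed

lemma sig_algebra_image: "sig_algebra B"
  by unfold_locales (auto simp: carrier_eq ops closed)

lemma modal_algebra_image:
  assumes "modal_algebra A"
  shows "modal_algebra B"
proof -
  interpret M: modal_algebra A by fact
  interpret sig_algebra B by (rule sig_algebra_image)
  show ?thesis
    by unfold_locales
      (auto simp: carrier_eq ops closed
        intro!: arg_cong[where f = h] M.vee_assoc M.wedge_assoc M.vee_comm M.wedge_comm
          M.vee_absorb M.wedge_absorb M.wedge_distrib M.vee_distrib M.vee_zero M.wedge_one
          M.vee_compl M.wedge_compl M.box_one M.box_wedge)
qed

lemma diamond: "x \<in> carrier A \<Longrightarrow> diamond B (h x) = h (diamond A x)"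
  by (simp add: diamond_def ops closed)

lemma diamond_pow: "(diamond B ^^ n) (h (one A)) = h ((diamond A ^^ n) (one A))"
  by (induction n) (auto simp: diamond A.diamond_pow_closed)

lemma mem_C_image_iff:
  assumes "modal_algebra A"
  shows "B \<in> C \<longleftrightarrow> A \<in> C"
  using assms modal_algebra_image
  by (simp add: mem_C_iff carrier_eq diamond_pow ops A.diamond_pow_closed closed
      inj_on_eq_iff[OF inj])

lemma interp_closed: "range v \<subseteq> carrier A \<Longrightarrow> interp A v t \<in> carrier A"
  by (induction t) (auto simp: closed)

lemma interp_image: "range v \<subseteq> carrier A \<Longrightarrow> interp B (h \<circ> v) t = h (interp A v t)"
  by (induction t) (auto simp: ops interp_closed)

lemma satisfies_image_iff: "satisfies B e \<longleftrightarrow> satisfies A e"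
proof
  assume B: "satisfies B e"
  show "satisfies A e"
    unfolding satisfies_def
  proof (intro allI impI)
    fix v :: "nat \<Rightarrow> 'a"
    assume v: "range v \<subseteq> carrier A"
    then have "range (h \<circ> v) \<subseteq> carrier B" by (auto simp: carrier_eq)
    with B have "interp B (h \<circ> v) (fst e) = interp B (h \<circ> v) (snd e)"
      unfolding satisfies_def by blast
    then show "interp A v (fst e) = interp A v (snd e)"
      using v by (simp add: interp_image interp_closed inj_on_eq_iff[OF inj])
  qed
next
  assume A: "satisfies A e"
  show "satisfies B e"
    unfolding satisfies_def
  proof (intro allI impI)
    fix w :: "nat \<Rightarrow> 'b"
    assume w: "range w \<subseteq> carrier B"
    define v where "v = inv_into (carrier A) h \<circ> w"
    have v: "range v \<subseteq> carrier A" and "w = h \<circ> v"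
      using w by (auto simp: v_def carrier_eq inv_into_into f_inv_into_f fun_eq_iff image_subset_iff)
    then show "interp B w (fst e) = interp B w (snd e)"
      using A by (simp add: interp_image satisfies_def)
  qed
qed

end

definition transport :: "('a \<Rightarrow> 'b) \<Rightarrow> 'a modal_alg \<Rightarrow> 'b modal_alg"
  where "transport h A = (let k = inv_into (carrier A) h in
    \<lparr>carrier = h ` carrier A,
     vee = \<lambda>x y. h (vee A (k x) (k y)),
     wedge = \<lambda>x y. h (wedge A (k x) (k y)),
     compl = \<lambda>x. h (compl A (k x)),
     box = \<lambda>x. h (box A (k x)),
     zero = h (zero A),
     one = h (one A)\<rparr>)"

lemma alg_iso_transport:
  assumes "inj_on h (carrier A)"
  shows "alg_iso h A (transport h A)"
  using assms by (simp add: alg_iso_def transport_def bij_betw_def Let_def)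

section \<open>Chains with a root\<close>

text \<open>This is the ordinal \<open>\<omega> + 1\<close>, each point seeing the smaller ones, with the finite ordinals moved up
  by one and \<open>\<omega>\<close> renamed to \<open>0\<close>. With this naming the set \<open>{0, \<dots>, n}\<close> keeps the top point, and
  truncation is plain intersection.\<close>

definition sees :: "nat \<Rightarrow> nat \<Rightarrow> bool"
  where "sees x y \<longleftrightarrow> y \<noteq> 0 \<and> (x = 0 \<or> y < x)"

definition chain_alg :: "nat set \<Rightarrow> nat set modal_alg"
  where "chain_alg W =
    \<lparr>carrier = {X. X \<subseteq> W \<and> (finite X \<or> finite (W - X))},
     vee = (\<union>), wedge = (\<inter>), compl = (\<lambda>X. W - X),
     box = (\<lambda>X. {x \<in> W. \<forall>y \<in> W. sees x y \<longrightarrow> y \<in> X}),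
     zero = {}, one = W\<rparr>"

lemma chain_alg_simps [simp]:
  "carrier (chain_alg W) = {X. X \<subseteq> W \<and> (finite X \<or> finite (W - X))}"
  "vee (chain_alg W) X Y = X \<union> Y" "wedge (chain_alg W) X Y = X \<inter> Y"
  "compl (chain_alg W) X = W - X"
  "box (chain_alg W) X = {x \<in> W. \<forall>y \<in> W. sees x y \<longrightarrow> y \<in> X}"
  "zero (chain_alg W) = {}" "one (chain_alg W) = W"
  by (simp_all add: chain_alg_def)

text \<open>A set \<open>\<box>X\<close> is either everything or bounded, since a nonzero point outside \<open>X\<close> is seen from all
  larger points and from \<open>0\<close>. This makes the finite and cofinite sets closed under \<open>\<box>\<close>.\<close>

lemma box_chain_cases:
  "box (chain_alg W) X = W \<or> finite (box (chain_alg W) X)"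
proof (cases "\<exists>m \<in> W. m \<noteq> 0 \<and> m \<notin> X")
  case True
  then obtain m where "m \<in> W" "m \<noteq> 0" "m \<notin> X" by blast
  then have "box (chain_alg W) X \<subseteq> {..m}"
    by (auto simp: sees_def not_less)
  then show ?thesis using finite_subset by blast
next
  case False
  then show ?thesis by (auto simp: sees_def)
qed

lemma sig_algebra_chain: "sig_algebra (chain_alg W)"
proof
  fix X Y
  assume X: "X \<in> carrier (chain_alg W)" and Y: "Y \<in> carrier (chain_alg W)"
  show "vee (chain_alg W) X Y \<in> carrier (chain_alg W)"
    using X Y by (auto simp: Un_Diff Diff_Un)
  show "wedge (chain_alg W) X Y \<in> carrier (chain_alg W)"
    using X Y by (auto simp: Diff_Int)
next
  fix X
  assume X: "X \<in> carrier (chain_alg W)"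
  then show "compl (chain_alg W) X \<in> carrier (chain_alg W)"
    by (auto simp: double_diff)
  show "box (chain_alg W) X \<in> carrier (chain_alg W)"
    using box_chain_cases[of W X] by auto
qed auto

lemma modal_algebra_chain: "modal_algebra (chain_alg W)"
proof -
  interpret sig_algebra "chain_alg W" by (rule sig_algebra_chain)
  show ?thesis by unfold_locales auto
qed

lemma chain_transitive:
  "wedge (chain_alg W) (box (chain_alg W) X) (box (chain_alg W) (box (chain_alg W) X))
    = box (chain_alg W) X"
  by (auto simp: sees_def)

section \<open>The iterated diamonds\<close>

lemma diamond_chain:
  "X \<subseteq> W \<Longrightarrow> diamond (chain_alg W) X = {x \<in> W. \<exists>y \<in> X. sees x y}"
  by (auto simp: diamond_def)

text \<open>A nonzero point \<open>x\<close> sees only nonzero points below it, of which there are \<open>x - 1\<close>, so paths from it have length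
  at most \<open>x - 1\<close>.\<close>

lemma diamond_pow_chain_subset:
  "(diamond (chain_alg W) ^^ n) W \<subseteq> {x \<in> W. x = 0 \<or> n < x}"
proof (induction n)
  case (Suc n)
  then have "(diamond (chain_alg W) ^^ Suc n) W
      = {x \<in> W. \<exists>y \<in> (diamond (chain_alg W) ^^ n) W. sees x y}"
    by (simp add: diamond_chain subset_iff)
  with Suc show ?case by (fastforce simp: sees_def)
qed auto

lemma diamond_pow_chain_UNIV:
  "(diamond (chain_alg UNIV) ^^ n) UNIV = {x. x = 0 \<or> n < x}"
proof (induction n)
  case (Suc n)
  have "(\<exists>y. (y = 0 \<or> n < y) \<and> sees x y) \<longleftrightarrow> x = 0 \<or> Suc n < x" for x
    by (auto simp: sees_def intro: exI[of _ "Suc n"])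
  with Suc show ?case by (simp add: diamond_chain)
qed auto

lemma finite_chain_in_C: "chain_alg {..n} \<in> C"
proof -
  let ?D = "diamond (chain_alg {..n})"
  have "(?D ^^ n) {..n} \<subseteq> {0}"
    using diamond_pow_chain_subset[of n "{..n}"] by auto
  \<comment> \<open>The bound for \<open>n\<close> steps leaves only the root, and no point sees the root.\<close>
  then have "?D ((?D ^^ n) {..n}) = {}"
    by (subst diamond_chain) (auto simp: sees_def)
  then have "(?D ^^ Suc n) {..n} = {}"
    by simp
  then have "X = {}" if "\<forall>k. X \<inter> (?D ^^ k) {..n} = X" for X
    using that by (metis inf_bot_right)
  then show ?thesis
    using chain_transitive[of "{..n}"] modal_algebra_chain[of "{..n}"]
    by (simp add: mem_C_iff)
qed

lemma infinite_chain_not_in_C: "chain_alg UNIV \<notin> C"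
proof
  assume "chain_alg UNIV \<in> C"
  then have "\<forall>X. finite X \<longrightarrow> (\<forall>n. X \<inter> (diamond (chain_alg UNIV) ^^ n) UNIV = X) \<longrightarrow> X = {}"
    by (simp add: mem_C_iff)
  from this[rule_format, of "{0}"] show False
    by (simp add: diamond_pow_chain_UNIV)
qed

section \<open>Equations pass from the finite chains to the infinite one\<close>

text \<open>Truncation fails to commute with \<open>\<box>\<close> only if \<open>0\<close> sees a point outside \<open>X\<close> but no such point up to
  \<open>n\<close>; a nonzero point of \<open>{0, \<dots>, n}\<close> sees nothing beyond \<open>n\<close>.\<close>

lemma eventually_truncate_box:
  "\<forall>\<^sub>F n in sequentially.
    box (chain_alg UNIV) X \<inter> {..n} = box (chain_alg {..n}) (X \<inter> {..n})"
proof (cases "\<exists>m. m \<noteq> 0 \<and> m \<notin> X")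
  case True
  then obtain m where m: "m \<noteq> 0" "m \<notin> X" by blast
  have "box (chain_alg UNIV) X \<inter> {..n} = box (chain_alg {..n}) (X \<inter> {..n})" if "m \<le> n" for n
    using m that by (auto simp: sees_def)
  then show ?thesis
    unfolding eventually_sequentially by blast
next
  case False
  then have "y \<in> X" if "y \<noteq> 0" for y
    using that by blast
  then have "box (chain_alg UNIV) X = UNIV" and "box (chain_alg {..n}) (X \<inter> {..n}) = {..n}" for n
    by (auto simp: sees_def)
  then show ?thesis by simp
qed

lemma eventually_truncate_interp:
  "\<forall>\<^sub>F n in sequentially.
    interp (chain_alg UNIV) v t \<inter> {..n} = interp (chain_alg {..n}) (\<lambda>i. v i \<inter> {..n}) t"
proof (induction t)
  case (Vee s t)
  then show ?case by eventually_elim auto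
next
  case (Wedge s t)
  then show ?case by eventually_elim auto
next
  case (Compl t)
  then show ?case by eventually_elim auto
next
  case (Box t)
  with eventually_truncate_box[of "interp (chain_alg UNIV) v t"] show ?case
    by eventually_elim (simp del: chain_alg_simps)
qed auto

lemma satisfies_infinite_chain:
  assumes "\<And>n. satisfies (chain_alg {..n}) e"
  shows "satisfies (chain_alg UNIV) e"
  unfolding satisfies_def
proof (intro allI impI)
  fix v :: "nat \<Rightarrow> nat set"
  let ?s = "interp (chain_alg UNIV) v (fst e)" and ?t = "interp (chain_alg UNIV) v (snd e)"
  have eq: "interp (chain_alg {..n}) (\<lambda>i. v i \<inter> {..n}) (fst e)
      = interp (chain_alg {..n}) (\<lambda>i. v i \<inter> {..n}) (snd e)" for n
    using assms[of n] by (auto simp: satisfies_def image_subset_iff)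
  have "\<forall>\<^sub>F n in sequentially. ?s \<inter> {..n} = ?t \<inter> {..n}"
    using eventually_truncate_interp[of v "fst e"] eventually_truncate_interp[of v "snd e"]
    by eventually_elim (simp add: eq)
  then obtain N where N: "\<And>n. N \<le> n \<Longrightarrow> ?s \<inter> {..n} = ?t \<inter> {..n}"
    unfolding eventually_sequentially by blast
  have "x \<in> ?s \<longleftrightarrow> x \<in> ?t" for x
  proof -
    have "x \<in> ?s \<inter> {..max N x} \<longleftrightarrow> x \<in> ?t \<inter> {..max N x}"
      using N[of "max N x"] by simp
    then show ?thesis by simp
  qed
  then show "?s = ?t" by blast
qed

section \<open>The class is not a variety\<close>

lemma countable_finite_cofinite: "countable {X :: nat set. finite X \<or> finite (- X)}"
proof -
  have fin: "countable {X :: nat set. finite X}"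
    using countable_Collect_finite_subset[of "UNIV :: nat set"] by simp
  have "{X :: nat set. finite X \<or> finite (- X)} \<subseteq> {X. finite X} \<union> uminus ` {X. finite X}"
    by (auto simp: image_iff intro: exI[of _ "- _"])
  then show ?thesis
    using fin by (meson countable_Un countable_image countable_subset)
qed

theorem corollary5p3:
  assumes "infinite (UNIV :: 'a set)"
  shows "\<not> is_variety (C :: 'a modal_alg set)"
proof
  assume "is_variety (C :: 'a modal_alg set)"
  then obtain E where E: "(C :: 'a modal_alg set) = models E"
    unfolding is_variety_def by blast
  let ?F = "{X :: nat set. finite X \<or> finite (- X)}"
  obtain f :: "nat \<Rightarrow> 'a" where f: "inj f"
    using infinite_countable_subset[OF assms] by blast
  \<comment> \<open>One injection serves all the chains: their carriers consist of finite and cofinite sets.\<close>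
  define g where "g = f \<circ> to_nat_on ?F"
  have g: "inj_on g ?F"
    unfolding g_def using countable_finite_cofinite f
    by (intro comp_inj_on inj_on_to_nat_on) (auto intro: inj_on_subset)
  have iso: "isomorphic_algebras (chain_alg W) g (transport g (chain_alg W))"
    if "W = UNIV \<or> finite W" for W
  proof -
    have "carrier (chain_alg W) \<subseteq> ?F"
      using that finite_subset by (auto simp: Compl_eq_Diff_UNIV)
    then have "inj_on g (carrier (chain_alg W))"
      using g inj_on_subset by blast
    then show ?thesis
      by (simp only: isomorphic_algebras_def isomorphic_algebras_axioms_def sig_algebra_chain
          alg_iso_transport simp_thms)
  qed
  interpret top: isomorphic_algebras "chain_alg UNIV" g "transport g (chain_alg UNIV)"
    by (rule iso) simp
  have "satisfies (chain_alg UNIV) e" if "e \<in> E" for e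
  proof (rule satisfies_infinite_chain)
    fix n
    interpret fin: isomorphic_algebras "chain_alg {..n}" g "transport g (chain_alg {..n})"
      by (rule iso) simp
    have "transport g (chain_alg {..n}) \<in> models E"
      using fin.mem_C_image_iff modal_algebra_chain finite_chain_in_C E by blast
    with that show "satisfies (chain_alg {..n}) e"
      by (simp add: models_def fin.satisfies_image_iff)
  qed
  then have "transport g (chain_alg UNIV) \<in> C"
    unfolding E models_def using top.sig_algebra_image top.satisfies_image_iff by blast
  then show False
    using top.mem_C_image_iff modal_algebra_chain infinite_chain_not_in_C by blast
qed

end
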